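(* Every tuple in the Urysohn space $\mathbb{U}$ consisting of distinct elements is ample.
   Context: The Urysohn space $\mathbb{U}$ is the unique, up to isometry, Polish metric space that is universal (every Polish metric space embeds isometrically into it) and homogeneous (every isometry between finite subspaces extends to an isometry of the whole space onto itself). It is viewed as the structure $(\mathbb{U},d)$ in the language having only the metric $d$; its automorphism group is $G=\mathrm{Iso}(\mathbb{U})$, the group of surjective isometries. Tuples are finite. For a tuple $\bar b$, $G_{\bar b}$ is the pointwise stabilizer of $\bar b$ in $G$, and for $W\subseteq G$, $W[\bar a]=\{w(\bar a):w\in W\}$. Formulas are classical first-order formulas in which real numbers may be used as constants of the second sort (e.g. $d(x,y)=r$ is a quantifier-free formula). $\mathrm{qftp}(\bar a)$ and $\mathrm{qftp}(\bar a/\bar b)$ denote the quantifier-free type of $\bar a$, respectively of $\bar a$ over $\bar b$; $p(\mathbb{U})$ is the set of realizations of $p$ in $\mathbb{U}$ (a subspace of $\mathbb{U}^n$). For an $n$-tuple $\bar a$, an $n$-tuple of variables $\bar x$ and $\epsilon>0$, a quantifier-free type $p(\bar x/\bar a)$ over $\bar a$ is an $\epsilon$-quantifier-free type over $\bar a$ if it contains $\mathrm{qftp}(\bar a)$ (in the variables $\bar x$) and for each $i\le n$ it contains $d(a^i,x^i)=d_i$ for some $0\le d_i<\epsilon$. For $p=\mathrm{qftp}(\bar a)$, a subset $Y\subseteq p(\mathbb{U})$ is relatively $\epsilon$-saturated over $\bar a$ if every $\epsilon$-quantifier-free type over $\bar a$ realized in $\mathbb{U}$ is also realized in $Y$. A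 tuple $\bar a$ with $p=\mathrm{qftp}(\bar a)$ is ample if the set of all tuples $\bar b\in p(\mathbb{U})$ such that $G_{\bar b}[\bar a]$ is relatively $\delta$-saturated over $\bar a$ for some $\delta>0$ is comeager in $p(\mathbb{U})$. *)

theory Defs
  imports "HOL-Analysis.Analysis"
begin

section \<open>The Urysohn space\<close>

definition isometry_group :: "('a::metric_space \<Rightarrow> 'a) set" where
  "isometry_group = {g. surj g \<and> (\<forall>x y. dist (g x) (g y) = dist x y)}"

text \<open>A separable metric space has at most the cardinality of the continuum, so up to isometry
  every Polish metric space is carried by a set of real numbers (with an arbitrary metric on it).
  Quantifying over \<^typ>\<open>real metric\<close> therefore covers all Polish metric spaces.\<close>

definition polish_universal :: "'a::metric_space itself \<Rightarrow> bool" where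
  "polish_universal _ \<longleftrightarrow>
     (\<forall>m :: real metric. mcomplete_of m \<and> separable_space (mtopology_of m) \<longrightarrow>
        (\<exists>f :: real \<Rightarrow> 'a. \<forall>x\<in>mspace m. \<forall>y\<in>mspace m. dist (f x) (f y) = mdist m x y))"

definition homogeneous :: "'a::metric_space itself \<Rightarrow> bool" where
  "homogeneous _ \<longleftrightarrow>
     (\<forall>(A :: 'a set) f. finite A \<and> (\<forall>x\<in>A. \<forall>y\<in>A. dist (f x) (f y) = dist x y) \<longrightarrow>
        (\<exists>g\<in>isometry_group. \<forall>x\<in>A. g x = f x))"

definition urysohn_space :: "'a::polish_space itself \<Rightarrow> bool" where
  "urysohn_space T \<longleftrightarrow> polish_universal T \<and> homogeneous T"


section \<open>Tuples and the group action\<close>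

text \<open>An \<open>n\<close>-tuple is an extensional function on \<open>{..<n}\<close>, indexed from \<open>0\<close>.\<close>

abbreviation tuples :: "nat \<Rightarrow> (nat \<Rightarrow> 'a) set" where
  "tuples n \<equiv> {..<n} \<rightarrow>\<^sub>E UNIV"

abbreviation entries :: "nat \<Rightarrow> (nat \<Rightarrow> 'a) \<Rightarrow> 'a set" where
  "entries n a \<equiv> a ` {..<n}"

definition tuple_stabilizer :: "nat \<Rightarrow> (nat \<Rightarrow> 'a::metric_space) \<Rightarrow> ('a \<Rightarrow> 'a) set" where
  "tuple_stabilizer n b = {g \<in> isometry_group. \<forall>i<n. g (b i) = b i}"

definition tuple_image :: "nat \<Rightarrow> ('a \<Rightarrow> 'a) set \<Rightarrow> (nat \<Rightarrow> 'a) \<Rightarrow> (nat \<Rightarrow> 'a) set" where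
  "tuple_image n W a = (\<lambda>w. restrict (w \<circ> a) {..<n}) ` W"


section \<open>Quantifier-free formulas and types\<close>

text \<open>The two-sorted language has the metric as its only nonlogical symbol (besides equality on
  both sorts) and constants for all real numbers; \<open>Par c\<close> is the constant of
  the first sort naming the parameter \<open>c\<close>. Free variables are of the first sort only, since
  types are types of tuples of points.\<close>

datatype 'a point_term = Var nat | Par 'a

datatype 'a real_term = Dist "'a point_term" "'a point_term" | Const real

datatype 'a qf_formula =
    PointEq "'a point_term" "'a point_term"
  | RealEq "'a real_term" "'a real_term"
  | Neg "'a qf_formula"
  | Conj "'a qf_formula" "'a qf_formula"
  | Disj "'a qf_formula" "'a qf_formula"

primrec point_value :: "(nat \<Rightarrow> 'a) \<Rightarrow> 'a point_term \<Rightarrow> 'a" where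
  "point_value x (Var i) = x i"
| "point_value x (Par c) = c"

primrec real_value :: "(nat \<Rightarrow> 'a::metric_space) \<Rightarrow> 'a real_term \<Rightarrow> real" where
  "real_value x (Dist s t) = dist (point_value x s) (point_value x t)"
| "real_value x (Const r) = r"

primrec satisfies :: "(nat \<Rightarrow> 'a::metric_space) \<Rightarrow> 'a qf_formula \<Rightarrow> bool" where
  "satisfies x (PointEq s t) \<longleftrightarrow> point_value x s = point_value x t"
| "satisfies x (RealEq s t) \<longleftrightarrow> real_value x s = real_value x t"
| "satisfies x (Neg \<phi>) \<longleftrightarrow> \<not> satisfies x \<phi>"
| "satisfies x (Conj \<phi> \<psi>) \<longleftrightarrow> satisfies x \<phi> \<and> satisfies x \<psi>"
| "satisfies x (Disj \<phi> \<psi>) \<longleftrightarrow> satisfies x \<phi> \<or> satisfies x \<psi>"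

primrec point_term_over :: "nat \<Rightarrow> 'a set \<Rightarrow> 'a point_term \<Rightarrow> bool" where
  "point_term_over n B (Var i) \<longleftrightarrow> i < n"
| "point_term_over n B (Par c) \<longleftrightarrow> c \<in> B"

primrec real_term_over :: "nat \<Rightarrow> 'a set \<Rightarrow> 'a real_term \<Rightarrow> bool" where
  "real_term_over n B (Dist s t) \<longleftrightarrow> point_term_over n B s \<and> point_term_over n B t"
| "real_term_over n B (Const r) \<longleftrightarrow> True"

primrec formula_over :: "nat \<Rightarrow> 'a set \<Rightarrow> 'a qf_formula \<Rightarrow> bool" where
  "formula_over n B (PointEq s t) \<longleftrightarrow> point_term_over n B s \<and> point_term_over n B t"
| "formula_over n B (RealEq s t) \<longleftrightarrow> real_term_over n B s \<and> real_term_over n B t"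
| "formula_over n B (Neg \<phi>) \<longleftrightarrow> formula_over n B \<phi>"
| "formula_over n B (Conj \<phi> \<psi>) \<longleftrightarrow> formula_over n B \<phi> \<and> formula_over n B \<psi>"
| "formula_over n B (Disj \<phi> \<psi>) \<longleftrightarrow> formula_over n B \<phi> \<and> formula_over n B \<psi>"

definition qftp_over :: "nat \<Rightarrow> (nat \<Rightarrow> 'a::metric_space) \<Rightarrow> 'a set \<Rightarrow> 'a qf_formula set" where
  "qftp_over n a B = {\<phi>. formula_over n B \<phi> \<and> satisfies a \<phi>}"

abbreviation qftp :: "nat \<Rightarrow> (nat \<Rightarrow> 'a::metric_space) \<Rightarrow> 'a qf_formula set" where
  "qftp n a \<equiv> qftp_over n a {}"

definition realizations :: "nat \<Rightarrow> 'a::metric_space qf_formula set \<Rightarrow> (nat \<Rightarrow> 'a) set" where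
  "realizations n p = {x \<in> tuples n. \<forall>\<phi>\<in>p. satisfies x \<phi>}"

text \<open>Types are finitely satisfiable but need not be complete. For relative saturation below this
  makes no difference: a realized partial type is contained in the complete type of any of its
  realizations.\<close>

definition qf_type :: "nat \<Rightarrow> 'a::metric_space set \<Rightarrow> 'a qf_formula set \<Rightarrow> bool" where
  "qf_type n B p \<longleftrightarrow>
     (\<forall>\<phi>\<in>p. formula_over n B \<phi>) \<and>
     (\<forall>q. q \<subseteq> p \<and> finite q \<longrightarrow> realizations n q \<noteq> {})"


section \<open>Relative saturation and ample tuples\<close>

definition eps_qf_type ::
    "nat \<Rightarrow> real \<Rightarrow> (nat \<Rightarrow> 'a::metric_space) \<Rightarrow> 'a qf_formula set \<Rightarrow> bool" where
  "eps_qf_type n \<epsilon> a p \<longleftrightarrow>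
     qf_type n (entries n a) p \<and> qftp n a \<subseteq> p \<and>
     (\<forall>i<n. \<exists>d. 0 \<le> d \<and> d < \<epsilon> \<and> RealEq (Dist (Par (a i)) (Var i)) (Const d) \<in> p)"

definition relatively_saturated ::
    "nat \<Rightarrow> real \<Rightarrow> (nat \<Rightarrow> 'a::metric_space) \<Rightarrow> (nat \<Rightarrow> 'a) set \<Rightarrow> bool" where
  "relatively_saturated n \<epsilon> a Y \<longleftrightarrow>
     Y \<subseteq> realizations n (qftp n a) \<and>
     (\<forall>p. eps_qf_type n \<epsilon> a p \<and> realizations n p \<noteq> {} \<longrightarrow> realizations n p \<inter> Y \<noteq> {})"

definition nowhere_dense_in :: "'b topology \<Rightarrow> 'b set \<Rightarrow> bool" where
  "nowhere_dense_in X S \<longleftrightarrow> S \<subseteq> topspace X \<and> X interior_of (X closure_of S) = {}"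

definition meager_in :: "'b topology \<Rightarrow> 'b set \<Rightarrow> bool" where
  "meager_in X S \<longleftrightarrow> (\<exists>F :: nat \<Rightarrow> 'b set. (\<forall>k. nowhere_dense_in X (F k)) \<and> S = (\<Union>k. F k))"

definition comeager_in :: "'b topology \<Rightarrow> 'b set \<Rightarrow> bool" where
  "comeager_in X S \<longleftrightarrow> S \<subseteq> topspace X \<and> meager_in X (topspace X - S)"

definition realization_space ::
    "nat \<Rightarrow> 'a::metric_space qf_formula set \<Rightarrow> (nat \<Rightarrow> 'a) topology" where
  "realization_space n p =
     subtopology (product_topology (\<lambda>_. euclidean) {..<n}) (realizations n p)"

definition ample :: "nat \<Rightarrow> (nat \<Rightarrow> 'a::metric_space) \<Rightarrow> bool" where
  "ample n a \<longleftrightarrow>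
     comeager_in (realization_space n (qftp n a))
       {b \<in> realizations n (qftp n a).
          \<exists>\<delta>>0. relatively_saturated n \<delta> a (tuple_image n (tuple_stabilizer n b) a)}"

end

theory Submission
  imports Defs
begin

text \<open>By homogeneity, the orbit of \<open>a\<close> under the stabilizer of \<open>b\<close> consists of all tuples with the same
  mutual distances as \<open>a\<close> and the same distances to the entries of \<open>b\<close>. So a configuration \<open>x\<close> near
  \<open>a\<close>, isometric to \<open>a\<close>, has the same type over \<open>a\<close> as some member of the orbit exactly when \<open>x\<close>,
  positioned relative to \<open>a\<close> as it is, can be amalgamated with \<open>b\<close> over \<open>a\<close> in such a way that \<open>x i\<close>
  gets the distance \<open>dist (a i) (b j)\<close> to \<open>b j\<close>. The only triangles of this amalgam not already
  present in the Urysohn space are those on \<open>x i\<close>, \<open>a k\<close>, \<open>b j\<close>; their sides are within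
  \<open>dist (x i) (a i)\<close> of those of the triangle on \<open>a i\<close>, \<open>a k\<close>, \<open>b j\<close>. Hence if the latter satisfy the
  triangle inequalities with slack \<open>\<delta>\<close> (for the degenerate triangles with \<open>i = k\<close>, only the one
  saying that \<open>a i\<close> and \<open>b j\<close> are apart), then the orbit is relatively \<open>\<delta>\<close>-saturated over \<open>a\<close>
  (\<open>strict_triangles_saturated\<close>).

  Having slack is an open condition on \<open>b\<close> (\<open>strict_triangles_perturb\<close>). It is also dense
  (\<open>strict_triangles_approx\<close>): replacing the distances \<open>t\<close> from the entries of \<open>b\<close> to finitely many
  given points by \<open>(1 - \<eta>) * t + \<epsilon>\<close>, with \<open>\<eta>\<close> small compared with \<open>\<epsilon>\<close>, moves \<open>b\<close> by \<open>\<epsilon>\<close> only; the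
  contraction makes the differences of distances to two distinct entries of \<open>a\<close> strictly smaller than
  the distance of these entries, and the shift makes the sums strictly larger. The distinctness of
  the entries of \<open>a\<close> is what gives the contraction something to act on. So the good tuples \<open>b\<close> contain
  a dense open set.

  Both uses of the Urysohn space are instances of \<open>urysohn_extension\<close>: an isometric copy of a given
  finite tuple can be placed at any prescribed compatible distances from a finite set.\<close>

section \<open>Finite configurations in the Urysohn space\<close>

text \<open>Universality, transported to an arbitrary index type. Pseudometrics rather than metrics are
  realized so that amalgams may identify points. Identified points share a representative \<open>r x\<close>,
  and the quotient is carried by the finite set of reals coding the representatives.\<close>

lemma finite_pseudometric_realized:
  fixes D :: "'b \<Rightarrow> 'b \<Rightarrow> real"
  assumes U: "polish_universal TYPE('a::polish_space)" and fin: "finite S"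
    and nonneg: "\<And>x y. x \<in> S \<Longrightarrow> y \<in> S \<Longrightarrow> 0 \<le> D x y"
    and refl: "\<And>x. x \<in> S \<Longrightarrow> D x x = 0"
    and sym: "\<And>x y. x \<in> S \<Longrightarrow> y \<in> S \<Longrightarrow> D x y = D y x"
    and tri: "\<And>x y z. x \<in> S \<Longrightarrow> y \<in> S \<Longrightarrow> z \<in> S \<Longrightarrow> D x z \<le> D x y + D y z"
  shows "\<exists>h :: 'b \<Rightarrow> 'a. \<forall>x\<in>S. \<forall>y\<in>S. dist (h x) (h y) = D x y"
proof -
  obtain c :: "'b \<Rightarrow> nat" where c: "inj_on c S"
    using finite_imp_inj_to_nat_seg[OF fin] by blast
  define r where "r x = (SOME y. y \<in> S \<and> D x y = 0)" for x
  have r: "r x \<in> S \<and> D x (r x) = 0" if "x \<in> S" for x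
    unfolding r_def by (rule someI[of _ x]) (use that refl in auto)
  have same: "D x z = D y z" if "x \<in> S" "y \<in> S" "z \<in> S" "D x y = 0" for x y z
    using tri[of x y z] tri[of y x z] sym[of x y] that by auto
  have r_eq: "r x = r y" if "x \<in> S" "y \<in> S" "D x y = 0" for x y
  proof -
    have "(\<lambda>z. z \<in> S \<and> D x z = 0) = (\<lambda>z. z \<in> S \<and> D y z = 0)"
      using same[OF that(1,2) _ that(3)] by metis
    then show ?thesis unfolding r_def by simp
  qed
  have D_r: "D (r x) (r y) = D x y" if "x \<in> S" "y \<in> S" for x y
  proof -
    have "D x y = D (r x) y" using same[of x "r x" y] r that by blast
    also have "\<dots> = D y (r x)" using sym r that by blast
    also have "\<dots> = D (r y) (r x)" using same[of y "r y" "r x"] r that by blast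
    also have "\<dots> = D (r x) (r y)" using sym r that by blast
    finally show ?thesis by simp
  qed
  define e where "e x = real (c (r x))" for x
  define p where "p t = inv_into S (\<lambda>x. real (c x)) t" for t
  have inj: "inj_on (\<lambda>x. real (c x)) S"
    using c by (auto simp: inj_on_def)
  have pe: "p (e x) = r x" if "x \<in> S" for x
    unfolding p_def e_def using inv_into_f_f[OF inj] r that by auto
  define d where "d s t = (if s \<in> e ` S \<and> t \<in> e ` S then D (p s) (p t) else 0)" for s t
  have d_e: "d (e x) (e y) = D x y" if "x \<in> S" "y \<in> S" for x y
    using that by (auto simp: d_def pe D_r)
  interpret Metric_space "e ` S" d
  proof
    show "0 \<le> d s t" for s t
      using nonneg r by (auto simp: d_def pe)
    show "d s t = d t s" for s t
      using sym r by (simp add: d_def) (metis imageE pe)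
    show "d s t = 0 \<longleftrightarrow> s = t" if s: "s \<in> e ` S" and t: "t \<in> e ` S" for s t
    proof -
      obtain x y where xy: "x \<in> S" "y \<in> S" "s = e x" "t = e y" using s t by blast
      have "e x = e y" if "D x y = 0" using r_eq[OF xy(1,2) that] by (simp add: e_def)
      moreover have "D x y = 0" if "e x = e y"
        using that d_e[of x y] d_e[of x x] refl[of x] xy by simp
      ultimately show ?thesis using xy by (auto simp: d_e)
    qed
    show "d s u \<le> d s t + d t u" if "s \<in> e ` S" "t \<in> e ` S" "u \<in> e ` S" for s t u
      using that tri by (auto simp: d_e)
  qed
  have "compact_space mtopology"
    using fin by (simp add: compact_space_def finite_imp_compactin)
  then have "mcomplete_of (metric (e ` S, d))"
    using compact_space_imp_mcomplete by simp
  moreover have "separable_space (mtopology_of (metric (e ` S, d)))"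
    unfolding separable_space_def
    using fin closure_of_topspace[of mtopology]
    by (intro exI[of _ "e ` S"]) (simp add: countable_finite)
  ultimately obtain f :: "real \<Rightarrow> 'a"
    where "\<forall>s\<in>e ` S. \<forall>t\<in>e ` S. dist (f s) (f t) = d s t"
    using U unfolding polish_universal_def by fastforce
  then show ?thesis
    by (intro exI[of _ "f \<circ> e"]) (simp add: d_e)
qed

lemma urysohn_homogeneous:
  fixes f :: "'a::polish_space \<Rightarrow> 'a"
  assumes "urysohn_space TYPE('a)" "finite A"
    and "\<And>x y. x \<in> A \<Longrightarrow> y \<in> A \<Longrightarrow> dist (f x) (f y) = dist x y"
  shows "\<exists>\<gamma>\<in>isometry_group. \<forall>x\<in>A. \<gamma> x = f x"
  using assms(1)[unfolded urysohn_space_def homogeneous_def, THEN conjunct2, rule_format, of A f]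
    assms(2,3) by simp

text \<open>The hypotheses say exactly that the distances in \<open>Z\<close>, the distances in \<open>c\<close> and the cross
  distances \<open>g\<close> form a pseudometric on the disjoint union of \<open>Z\<close> and \<open>J\<close>. Universality realizes this
  pseudometric somewhere, and homogeneity moves the copy of \<open>Z\<close> back to \<open>Z\<close>.\<close>

lemma urysohn_extension:
  fixes Z :: "'a::polish_space set" and c :: "'i \<Rightarrow> 'b::metric_space"
  assumes U: "urysohn_space TYPE('a)" and fin: "finite Z" "finite J"
    and lip: "\<And>j z w. j \<in> J \<Longrightarrow> z \<in> Z \<Longrightarrow> w \<in> Z \<Longrightarrow> g j z \<le> g j w + dist w z"
    and wide: "\<And>j z w. j \<in> J \<Longrightarrow> z \<in> Z \<Longrightarrow> w \<in> Z \<Longrightarrow> dist z w \<le> g j z + g j w"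
    and close: "\<And>j k z. j \<in> J \<Longrightarrow> k \<in> J \<Longrightarrow> z \<in> Z \<Longrightarrow> g j z \<le> g k z + dist (c j) (c k)"
    and far: "\<And>j k z. j \<in> J \<Longrightarrow> k \<in> J \<Longrightarrow> z \<in> Z \<Longrightarrow> dist (c j) (c k) \<le> g j z + g k z"
  shows "\<exists>x. (\<forall>j\<in>J. \<forall>k\<in>J. dist (x j) (x k) = dist (c j) (c k)) \<and>
             (\<forall>j\<in>J. \<forall>z\<in>Z. dist (x j) z = g j z)"
proof -
  define D where "D s t = (case (s, t) of
      (Inl z, Inl w) \<Rightarrow> dist z w | (Inl z, Inr j) \<Rightarrow> g j z
    | (Inr j, Inl z) \<Rightarrow> g j z | (Inr j, Inr k) \<Rightarrow> dist (c j) (c k))" for s t :: "'a + 'i"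
  have g_nonneg: "0 \<le> g j z" if "j \<in> J" "z \<in> Z" for j z
    using wide[of j z z] that by simp
  have "\<exists>h :: 'a + 'i \<Rightarrow> 'a. \<forall>s \<in> Z <+> J. \<forall>t \<in> Z <+> J. dist (h s) (h t) = D s t"
  proof (rule finite_pseudometric_realized)
    show "polish_universal TYPE('a)" using U by (simp add: urysohn_space_def)
    show "finite (Z <+> J)" using fin by simp
    show "D s u \<le> D s t + D t u" if "s \<in> Z <+> J" "t \<in> Z <+> J" "u \<in> Z <+> J" for s t u
      using that lip wide close far
      by (auto simp: D_def dist_triangle add.commute dist_commute elim!: PlusE)
        (metis dist_commute add.commute)+
  qed (auto simp: D_def dist_commute g_nonneg)
  then obtain h :: "'a + 'i \<Rightarrow> 'a"
    where h: "\<And>s t. s \<in> Z <+> J \<Longrightarrow> t \<in> Z <+> J \<Longrightarrow> dist (h s) (h t) = D s t"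
    by blast
  define f where "f u = inv_into Z (h \<circ> Inl) u" for u
  have inj: "inj_on (h \<circ> Inl) Z"
  proof (rule inj_onI)
    fix z w assume "z \<in> Z" "w \<in> Z" "(h \<circ> Inl) z = (h \<circ> Inl) w"
    then show "z = w" using h[OF InlI InlI, of z w] by (simp add: D_def)
  qed
  have f: "f (h (Inl z)) = z" if "z \<in> Z" for z
    unfolding f_def using inv_into_f_f[OF inj that] by simp
  have "finite (h ` Inl ` Z)" using fin by simp
  moreover have "dist (f u) (f v) = dist u v" if "u \<in> h ` Inl ` Z" "v \<in> h ` Inl ` Z" for u v
    using that by (auto simp: f h[OF InlI InlI] D_def)
  ultimately have "\<exists>\<gamma>\<in>isometry_group. \<forall>u\<in>h ` Inl ` Z. \<gamma> u = f u"
    by (rule urysohn_homogeneous[OF U])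
  then obtain \<gamma> where \<gamma>: "\<gamma> \<in> isometry_group" "\<forall>u\<in>h ` Inl ` Z. \<gamma> u = f u"
    by blast
  have iso: "dist (\<gamma> u) (\<gamma> v) = dist u v" for u v
    using \<gamma>(1) by (simp add: isometry_group_def)
  have fix_Z: "\<gamma> (h (Inl z)) = z" if "z \<in> Z" for z
    using \<gamma>(2) f that by simp
  show ?thesis
  proof (intro exI[of _ "\<lambda>j. \<gamma> (h (Inr j))"] conjI ballI)
    fix j k assume "j \<in> J" "k \<in> J"
    then show "dist (\<gamma> (h (Inr j))) (\<gamma> (h (Inr k))) = dist (c j) (c k)"
      using h[OF InrI InrI, of j k] by (simp add: iso D_def)
  next
    fix j z assume jz: "j \<in> J" "z \<in> Z"
    then show "dist (\<gamma> (h (Inr j))) z = g j z"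
      using iso[of "h (Inr j)" "h (Inl z)"] h[OF InrI InlI, of j z]
      by (simp add: fix_Z D_def)
  qed
qed


section \<open>Quantifier-free types and distances\<close>

text \<open>Equality of points is itself a statement about distances, so the truth of a quantifier-free
  formula depends on nothing but distances.\<close>

lemma satisfies_cong_dist:
  assumes vars: "\<And>i j. i < n \<Longrightarrow> j < n \<Longrightarrow> dist (x i) (x j) = dist (y i) (y j)"
    and pars: "\<And>i c. i < n \<Longrightarrow> c \<in> B \<Longrightarrow> dist (x i) c = dist (y i) c"
    and \<phi>: "formula_over n B \<phi>"
  shows "satisfies x \<phi> \<longleftrightarrow> satisfies y \<phi>"
proof -
  have pt: "dist (point_value x s) (point_value x t) = dist (point_value y s) (point_value y t)"
    if "point_term_over n B s" "point_term_over n B t" for s t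
    using that vars pars by (cases s; cases t) (auto simp: dist_commute)
  have re: "real_value x s = real_value y s" if "real_term_over n B s" for s
    using that pt by (cases s) auto
  show ?thesis
    using \<phi>
  proof (induction \<phi>)
    case (PointEq s t)
    then show ?case
      using pt[of s t] by (metis dist_eq_0_iff formula_over.simps(1) satisfies.simps(1))
  qed (use re in auto)
qed

lemma realizations_qftp:
  fixes a :: "nat \<Rightarrow> 'a::metric_space"
  shows "realizations n (qftp n a) =
     {x \<in> tuples n. \<forall>i<n. \<forall>j<n. dist (x i) (x j) = dist (a i) (a j)}"
proof (intro equalityI subsetI CollectI conjI allI impI)
  fix x :: "nat \<Rightarrow> 'a" and i j
  assume x: "x \<in> realizations n (qftp n a)" and "i < n" "j < n"
  then have "RealEq (Dist (Var i) (Var j)) (Const (dist (a i) (a j))) \<in> qftp n a"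
    by (simp add: qftp_over_def)
  with x have "satisfies x (RealEq (Dist (Var i) (Var j)) (Const (dist (a i) (a j))))"
    unfolding realizations_def by blast
  then show "dist (x i) (x j) = dist (a i) (a j)" by simp
next
  fix x :: "nat \<Rightarrow> 'a"
  assume "x \<in> {x \<in> tuples n. \<forall>i<n. \<forall>j<n. dist (x i) (x j) = dist (a i) (a j)}"
  then show "x \<in> realizations n (qftp n a)"
    using satisfies_cong_dist[of n x a "{}"]
    by (auto simp: realizations_def qftp_over_def)
qed (auto simp: realizations_def)


section \<open>Strict triangles\<close>

text \<open>The case \<open>i = k\<close> of the first inequality keeps \<open>a i\<close> away from \<open>b j\<close>. In the second one that
  case is excluded, since there it would read \<open>\<delta> \<le> 0\<close>.\<close>

definition strict_triangles ::
    "nat \<Rightarrow> real \<Rightarrow> (nat \<Rightarrow> 'a::metric_space) \<Rightarrow> (nat \<Rightarrow> 'a) \<Rightarrow> bool" where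
  "strict_triangles n \<delta> a b \<longleftrightarrow> (\<forall>i<n. \<forall>k<n. \<forall>j<n.
     dist (a i) (a k) + \<delta> \<le> dist (a i) (b j) + dist (a k) (b j) \<and>
     (i \<noteq> k \<longrightarrow> dist (a i) (b j) + \<delta> \<le> dist (a i) (a k) + dist (a k) (b j)))"

text \<open>Given a realization \<open>x\<close> of the type, the amalgam of \<open>x\<close> and \<open>b\<close> over \<open>a\<close> is realized by a tuple
  \<open>y\<close>, which has the distances of \<open>x\<close> to \<open>a\<close> and those of \<open>a\<close> to \<open>b\<close>. Then \<open>a \<mapsto> y\<close>, \<open>b \<mapsto> b\<close> is a partial
  isometry, so some member of the stabilizer of \<open>b\<close> takes \<open>a\<close> to \<open>y\<close>.\<close>

lemma strict_triangles_saturated: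
  fixes a b :: "nat \<Rightarrow> 'a::polish_space"
  assumes U: "urysohn_space TYPE('a)" and inj: "inj_on a {..<n}" and "0 < \<delta>"
    and b: "strict_triangles n \<delta> a b"
  shows "relatively_saturated n \<delta> a (tuple_image n (tuple_stabilizer n b) a)"
  unfolding relatively_saturated_def
proof (intro conjI allI impI)
  show "tuple_image n (tuple_stabilizer n b) a \<subseteq> realizations n (qftp n a)"
    unfolding realizations_qftp tuple_image_def tuple_stabilizer_def isometry_group_def
    by (auto simp: PiE_iff)
next
  fix p assume "eps_qf_type n \<delta> a p \<and> realizations n p \<noteq> {}"
  then obtain x where p: "eps_qf_type n \<delta> a p" and x: "x \<in> realizations n p"
    by blast
  have dxx: "dist (x i) (x k) = dist (a i) (a k)" if "i < n" "k < n" for i k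
  proof -
    have "x \<in> realizations n (qftp n a)"
      using p x by (auto simp: eps_qf_type_def realizations_def)
    then show ?thesis using that by (simp add: realizations_qftp)
  qed
  have dxa: "dist (x i) (a i) < \<delta>" if "i < n" for i
  proof -
    have "\<exists>d<\<delta>. RealEq (Dist (Par (a i)) (Var i)) (Const d) \<in> p"
      using p that unfolding eps_qf_type_def by blast
    then obtain d where "d < \<delta>" "RealEq (Dist (Par (a i)) (Var i)) (Const d) \<in> p"
      by blast
    moreover from this have "satisfies x (RealEq (Dist (Par (a i)) (Var i)) (Const d))"
      using x unfolding realizations_def by blast
    ultimately show ?thesis by (simp add: dist_commute)
  qed
  have wide: "dist (a i) (a k) + \<delta> \<le> dist (a i) (b j) + dist (a k) (b j)"
    and slim: "i \<noteq> k \<Longrightarrow> dist (a i) (b j) + \<delta> \<le> dist (a i) (a k) + dist (a k) (b j)"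
    if "i < n" "j < n" "k < n" for i j k
    using b that by (auto simp: strict_triangles_def)
  have disj: "a i \<noteq> b j" if "i < n" "j < n" for i j
    using wide[of i j i] that \<open>0 < \<delta>\<close> by auto
  \<comment> \<open>Unambiguous only because \<open>a\<close> and \<open>b\<close> have no common entry.\<close>
  define g where "g i z = (if z \<in> entries n b then dist (a i) z else dist (x i) z)" for i z
  have g_b: "g i (b j) = dist (a i) (b j)" if "j < n" for i j
    using that by (simp add: g_def)
  have g_a: "g i (a k) = dist (x i) (a k)" if "k < n" for i k
    using that disj by (auto simp: g_def)
  have near: "\<bar>dist (x i) (a k) - dist (a i) (a k)\<bar> < \<delta>" if "i < n" "k < n" for i k
    using dxa[of i] that dist_triangle[of "x i" "a k" "a i"] dist_triangle[of "a i" "a k" "x i"]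
    by (simp add: dist_commute)
  \<comment> \<open>The only new triangles; their inequalities use up the slack \<open>\<delta>\<close>.\<close>
  have mixed: "dist (a i) (b j) \<le> dist (x i) (a k) + dist (a k) (b j)"
    "dist (x i) (a k) \<le> dist (a i) (b j) + dist (a k) (b j)"
    "dist (a k) (b j) \<le> dist (a i) (b j) + dist (x i) (a k)"
    if "i < n" "j < n" "k < n" for i j k
    using near[of i k] wide[of i j k] slim[of i j k] slim[of k j i] that
    by (cases "i = k"; simp add: dist_commute)+
  have "\<exists>y. (\<forall>j\<in>{..<n}. \<forall>k\<in>{..<n}. dist (y j) (y k) = dist (x j) (x k)) \<and>
            (\<forall>j\<in>{..<n}. \<forall>z\<in>entries n a \<union> entries n b. dist (y j) z = g j z)"
  proof (rule urysohn_extension[OF U])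
    fix i z w
    assume i: "i \<in> {..<n}" and z: "z \<in> entries n a \<union> entries n b"
      and w: "w \<in> entries n a \<union> entries n b"
    show "g i z \<le> g i w + dist w z"
      using i z w mixed[of i] dist_triangle[of "x i" z w] dist_triangle[of "a i" z w]
      by (auto simp: g_a g_b dist_commute add.commute)
    show "dist z w \<le> g i z + g i w"
      using i z w mixed[of i] dist_triangle3[of z w "x i"] dist_triangle3[of z w "a i"]
      by (auto simp: g_a g_b dist_commute add.commute)
  next
    fix i k z
    assume "i \<in> {..<n}" "k \<in> {..<n}" "z \<in> entries n a \<union> entries n b"
    then show "g i z \<le> g k z + dist (x i) (x k)" "dist (x i) (x k) \<le> g i z + g k z"
      using dist_triangle[of "x i" z "x k"] dist_triangle[of "a i" z "a k"]
        dist_triangle2[of "x i" "x k" z] dist_triangle2[of "a i" "a k" z]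
      by (auto simp: g_def dxx)
  qed auto
  then obtain y where yy: "\<And>i k. i < n \<Longrightarrow> k < n \<Longrightarrow> dist (y i) (y k) = dist (x i) (x k)"
    and yz: "\<And>i z. i < n \<Longrightarrow> z \<in> entries n a \<union> entries n b \<Longrightarrow> dist (y i) z = g i z"
    by (metis lessThan_iff)
  define f where "f z = (if z \<in> entries n b then z else y (inv_into {..<n} a z))" for z
  have f_b: "f (b j) = b j" if "j < n" for j
    using that by (simp add: f_def)
  have f_a: "f (a i) = y i" if "i < n" for i
    using that disj inv_into_f_f[OF inj] by (auto simp: f_def)
  have yb: "dist (y i) (b j) = dist (a i) (b j)" "dist (b j) (y i) = dist (b j) (a i)"
    if "i < n" "j < n" for i j
    using yz[of i "b j"] that by (simp_all add: g_b dist_commute)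
  have "finite (entries n a \<union> entries n b)" by simp
  moreover have "dist (f z) (f w) = dist z w"
    if "z \<in> entries n a \<union> entries n b" "w \<in> entries n a \<union> entries n b" for z w
    using that by (auto simp: f_a f_b yy dxx yb)
  ultimately have "\<exists>\<gamma>\<in>isometry_group. \<forall>z\<in>entries n a \<union> entries n b. \<gamma> z = f z"
    by (rule urysohn_homogeneous[OF U])
  then obtain \<gamma> where \<gamma>: "\<gamma> \<in> isometry_group"
    "\<forall>z\<in>entries n a \<union> entries n b. \<gamma> z = f z"
    by blast
  define a' where "a' = restrict (\<gamma> \<circ> a) {..<n}"
  have a'_y: "a' i = y i" if "i < n" for i
    using \<gamma>(2) that by (simp add: a'_def f_a)
  have "a' \<in> tuple_image n (tuple_stabilizer n b) a"
    using \<gamma> by (auto simp: a'_def tuple_image_def tuple_stabilizer_def f_b)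
  moreover have "a' \<in> realizations n p"
  proof -
    have "satisfies a' \<phi>" if "\<phi> \<in> p" for \<phi>
    proof -
      have "formula_over n (entries n a) \<phi>"
        using p that by (simp add: eps_qf_type_def qf_type_def)
      then have "satisfies a' \<phi> \<longleftrightarrow> satisfies x \<phi>"
        by (intro satisfies_cong_dist[where n = n and B = "entries n a"])
          (auto simp: a'_y yy yz g_a)
      then show ?thesis using x that by (simp add: realizations_def)
    qed
    then show ?thesis by (simp add: realizations_def a'_def)
  qed
  ultimately show "realizations n p \<inter> tuple_image n (tuple_stabilizer n b) a \<noteq> {}"
    by blast
qed

text \<open>The perturbed tuple is obtained by applying the affine map \<open>F\<close> to all distances between entries
  of \<open>b\<close> and points of \<open>Z\<close>. Since \<open>F\<close> is a contraction and lies above the identity on the range of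
  distances in question, all triangle inequalities survive. Including the entries of \<open>b\<close> in \<open>Z\<close> pins
  the new tuple at distance \<open>F 0 = \<epsilon>\<close> from \<open>b\<close>.\<close>

lemma strict_triangles_approx:
  fixes a b :: "nat \<Rightarrow> 'a::polish_space"
  assumes U: "urysohn_space TYPE('a)" and inj: "inj_on a {..<n}" and "0 < \<epsilon>"
  shows "\<exists>b'\<in>tuples n. (\<forall>j<n. \<forall>k<n. dist (b' j) (b' k) = dist (b j) (b k)) \<and>
           (\<forall>j<n. dist (b' j) (b j) = \<epsilon>) \<and> (\<exists>\<delta>>0. strict_triangles n \<delta> a b')"
proof -
  define Z where "Z = entries n a \<union> entries n b"
  have "bounded Z" by (simp add: Z_def finite_imp_bounded)
  then obtain M where M: "\<And>z w. z \<in> Z \<Longrightarrow> w \<in> Z \<Longrightarrow> dist z w \<le> M"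
    unfolding bounded_two_points by blast
  define K where "K = \<bar>M\<bar> + \<epsilon>"
  have K: "0 < K" "\<epsilon> \<le> K" "\<And>z w. z \<in> Z \<Longrightarrow> w \<in> Z \<Longrightarrow> dist z w \<le> K"
    using M \<open>0 < \<epsilon>\<close> by (fastforce simp: K_def)+
  \<comment> \<open>On distances up to \<open>K\<close>, contraction by \<open>1 - \<eta>\<close> loses at most half of the shift \<open>\<epsilon>\<close>.\<close>
  define \<eta> where "\<eta> = \<epsilon> / (2 * K)"
  have \<eta>: "0 < \<eta>" "\<eta> < 1" "\<eta> * K = \<epsilon> / 2"
    using K \<open>0 < \<epsilon>\<close> by (auto simp: \<eta>_def field_simps)
  define F where "F t = (1 - \<eta>) * t + \<epsilon>" for t
  have F_lip: "F s \<le> F t + (1 - \<eta>) * u" if "s \<le> t + u" for s t u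
    using mult_left_mono[OF that, of "1 - \<eta>"] \<eta> by (simp add: F_def algebra_simps)
  have F_lip1: "F s \<le> F t + u" if "s \<le> t + u" "0 \<le> u" for s t u
    using F_lip[OF that(1)] mult_left_le_one_le[OF that(2), of "1 - \<eta>"] \<eta> by simp
  have F_above: "t + \<epsilon> / 2 \<le> F t" if "t \<le> K" for t
    using mult_left_mono[OF that, of \<eta>] \<eta> unfolding F_def left_diff_distrib by simp
  have aZ: "a i \<in> Z" and bZ: "b i \<in> Z" if "i < n" for i
    using that by (auto simp: Z_def)
  have "\<exists>x. (\<forall>j\<in>{..<n}. \<forall>k\<in>{..<n}. dist (x j) (x k) = dist (b j) (b k)) \<and>
            (\<forall>j\<in>{..<n}. \<forall>z\<in>Z. dist (x j) z = F (dist (b j) z))"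
  proof (rule urysohn_extension[OF U])
    fix j z w assume "j \<in> {..<n}" "z \<in> Z" "w \<in> Z"
    then show "F (dist (b j) z) \<le> F (dist (b j) w) + dist w z"
      "dist z w \<le> F (dist (b j) z) + F (dist (b j) w)"
      using F_lip1[OF dist_triangle] F_above[OF K(3)[OF bZ, of j z]]
        F_above[OF K(3)[OF bZ, of j w]] dist_triangle3[of z w "b j"] \<open>0 < \<epsilon>\<close>
      by (auto simp: dist_commute)
  next
    fix j k z assume "j \<in> {..<n}" "k \<in> {..<n}" "z \<in> Z"
    then show "F (dist (b j) z) \<le> F (dist (b k) z) + dist (b j) (b k)"
      "dist (b j) (b k) \<le> F (dist (b j) z) + F (dist (b k) z)"
      using F_lip1[of "dist (b j) z" "dist (b k) z" "dist (b j) (b k)"]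
        dist_triangle[of "b j" z "b k"] F_above[OF K(3)[OF bZ, of j z]]
        F_above[OF K(3)[OF bZ, of k z]] dist_triangle2[of "b j" "b k" z] \<open>0 < \<epsilon>\<close>
      by (auto simp: add.commute)
  qed (auto simp: Z_def)
  then obtain x where xx: "\<And>j k. j < n \<Longrightarrow> k < n \<Longrightarrow> dist (x j) (x k) = dist (b j) (b k)"
    and xz: "\<And>j z. j < n \<Longrightarrow> z \<in> Z \<Longrightarrow> dist (x j) z = F (dist (b j) z)"
    by (metis lessThan_iff)
  define b' where "b' = restrict x {..<n}"
  obtain s where s: "0 < s" "\<And>i k. i < n \<Longrightarrow> k < n \<Longrightarrow> i \<noteq> k \<Longrightarrow> s \<le> dist (a i) (a k)"
  proof -
    have "\<exists>s>0. \<forall>z\<in>entries n a - {w}. s \<le> dist w z" for w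
      using finite_set_avoid[of "entries n a" w] by auto
    then obtain \<sigma> where \<sigma>: "\<And>w. 0 < \<sigma> w" "\<And>w z. z \<in> entries n a - {w} \<Longrightarrow> \<sigma> w \<le> dist w z"
      by metis
    let ?S = "insert 1 (\<sigma> ` entries n a)"
    show thesis
    proof (rule that[of "Min ?S"])
      show "0 < Min ?S" using \<sigma>(1) by simp
      fix i k assume ik: "i < n" "k < n" "i \<noteq> k"
      then have "a k \<in> entries n a - {a i}" using inj by (auto simp: inj_on_def)
      then have "\<sigma> (a i) \<le> dist (a i) (a k)" by (rule \<sigma>(2))
      moreover have "Min ?S \<le> \<sigma> (a i)" using ik by (intro Min_le) auto
      ultimately show "Min ?S \<le> dist (a i) (a k)" by linarith
    qed
  qed
  \<comment> \<open>Two sides exceed the third by \<open>\<epsilon>\<close> due to the shift, or by \<open>\<eta> * s\<close> due to the contraction.\<close>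
  define \<delta> where "\<delta> = min \<epsilon> (\<eta> * s)"
  have "0 < \<delta>" using s(1) \<eta>(1) \<open>0 < \<epsilon>\<close> by (simp add: \<delta>_def)
  have "strict_triangles n \<delta> a b'"
    unfolding strict_triangles_def
  proof (intro allI impI conjI)
    fix i k j assume ijk: "i < n" "k < n" "j < n"
    have dF: "dist (a m) (b' j) = F (dist (b j) (a m))" if "m < n" for m
      using xz[OF ijk(3) aZ[OF that]] ijk by (simp add: b'_def dist_commute)
    show "dist (a i) (a k) + \<delta> \<le> dist (a i) (b' j) + dist (a k) (b' j)"
      using ijk F_above[OF K(3)[OF bZ aZ, of j i]] F_above[OF K(3)[OF bZ aZ, of j k]]
        dist_triangle3[of "a i" "a k" "b j"]
      by (simp add: dF \<delta>_def)
    assume "i \<noteq> k"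
    then have "\<delta> \<le> \<eta> * dist (a i) (a k)"
      using s(2)[of i k] mult_left_mono[of s "dist (a i) (a k)" \<eta>] ijk \<eta>(1)
      by (simp add: \<delta>_def min_le_iff_disj)
    then show "dist (a i) (b' j) + \<delta> \<le> dist (a i) (a k) + dist (a k) (b' j)"
      using F_lip[of "dist (b j) (a i)" "dist (b j) (a k)" "dist (a i) (a k)"]
        dist_triangle2[of "b j" "a i" "a k"] ijk
      by (simp add: dF algebra_simps)
  qed
  moreover have "dist (b' j) (b j) = \<epsilon>" if "j < n" for j
    using xz[OF that bZ[OF that]] that by (simp add: b'_def F_def)
  ultimately show ?thesis
    using xx \<open>0 < \<delta>\<close> by (intro bexI[of _ b']) (auto simp: b'_def)
qed

section \<open>Open dense sets of tuples\<close>

lemma openin_realization_space_iff: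
  "openin (realization_space n p) V \<longleftrightarrow> V \<subseteq> realizations n p \<and>
     (\<forall>b\<in>V. \<exists>\<epsilon>>0. \<forall>b'\<in>realizations n p. (\<forall>j<n. dist (b' j) (b j) < \<epsilon>) \<longrightarrow> b' \<in> V)"
  (is "?L \<longleftrightarrow> ?sub \<and> (\<forall>b\<in>V. \<exists>\<epsilon>>0. ?ball b \<epsilon>)")
proof
  assume ?L
  then obtain W where W: "openin (product_topology (\<lambda>_. euclidean) {..<n}) W"
    and V: "V = W \<inter> realizations n p"
    by (auto simp: realization_space_def openin_subtopology)
  show "?sub \<and> (\<forall>b\<in>V. \<exists>\<epsilon>>0. ?ball b \<epsilon>)"
  proof (intro conjI ballI)
    fix b assume "b \<in> V"
    then obtain O' where O': "\<forall>j<n. open (O' j)" "b \<in> Pi\<^sub>E {..<n} O'" "Pi\<^sub>E {..<n} O' \<subseteq> W"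
      using W unfolding V openin_product_topology_alt
      by (metis (lifting) IntD1 lessThan_iff open_openin)
    have "\<forall>j\<in>{..<n}. \<forall>\<^sub>F \<epsilon> in at_right 0. ball (b j) \<epsilon> \<subseteq> O' j"
    proof
      fix j assume "j \<in> {..<n}"
      then have "open (O' j)" "b j \<in> O' j" using O' by auto
      then obtain e where "e > 0" "ball (b j) e \<subseteq> O' j"
        using open_contains_ball by blast
      then show "\<forall>\<^sub>F \<epsilon> in at_right 0. ball (b j) \<epsilon> \<subseteq> O' j"
        unfolding eventually_at_right_field
        by (intro exI[of _ e]) (use subset_ball in fastforce)
    qed
    then have "\<forall>\<^sub>F \<epsilon> in at_right (0::real). \<forall>j\<in>{..<n}. ball (b j) \<epsilon> \<subseteq> O' j"
      by (intro eventually_ball_finite) auto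
    then obtain \<epsilon> :: real where "\<epsilon> > 0" "\<forall>j\<in>{..<n}. ball (b j) \<epsilon> \<subseteq> O' j"
      using eventually_happens'[OF trivial_limit_at_right_real]
        eventually_conj[OF eventually_at_right_less] by blast
    moreover from this have "?ball b \<epsilon>"
    proof (intro ballI impI)
      fix b' assume b': "b' \<in> realizations n p" "\<forall>j<n. dist (b' j) (b j) < \<epsilon>"
      then have "b' \<in> Pi\<^sub>E {..<n} O'"
        using \<open>\<forall>j\<in>{..<n}. ball (b j) \<epsilon> \<subseteq> O' j\<close>
        by (auto simp: realizations_def PiE_iff dist_commute subset_iff)
      then show "b' \<in> V" using O'(3) b' by (auto simp: V)
    qed
    ultimately show "\<exists>\<epsilon>>0. ?ball b \<epsilon>" by blast
  qed (simp add: V)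
next
  assume V: "?sub \<and> (\<forall>b\<in>V. \<exists>\<epsilon>>0. ?ball b \<epsilon>)"
  show ?L
    unfolding openin_subopen[of _ V]
  proof
    fix b assume "b \<in> V"
    with V obtain \<epsilon> where "\<epsilon> > 0" and \<epsilon>: "?ball b \<epsilon>" by blast
    let ?T = "Pi\<^sub>E {..<n} (\<lambda>j. ball (b j) \<epsilon>) \<inter> realizations n p"
    have "openin (realization_space n p) ?T"
      unfolding realization_space_def
      by (intro openin_subtopology_Int) (simp add: openin_PiE_gen)
    moreover have "b \<in> ?T"
      using V \<open>b \<in> V\<close> \<open>\<epsilon> > 0\<close> by (auto simp: realizations_def PiE_iff)
    moreover have "?T \<subseteq> V"
      using \<epsilon> by (auto simp: PiE_iff dist_commute)
    ultimately show "\<exists>T. openin (realization_space n p) T \<and> b \<in> T \<and> T \<subseteq> V" by blast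
  qed
qed

lemma strict_triangles_perturb:
  assumes "strict_triangles n \<delta> a b" and "\<And>j. j < n \<Longrightarrow> dist (b' j) (b j) < \<delta> / 4"
  shows "strict_triangles n (\<delta> / 2) a b'"
proof -
  have near: "\<bar>dist (a i) (b' j) - dist (a i) (b j)\<bar> < \<delta> / 4" if "j < n" for i j
    using assms(2)[OF that] dist_triangle[of "a i" "b' j" "b j"] dist_triangle[of "a i" "b j" "b' j"]
    unfolding dist_commute[of "b j" "b' j"] by arith
  show ?thesis
    unfolding strict_triangles_def
  proof (intro allI impI conjI)
    fix i k j assume ijk: "i < n" "k < n" "j < n"
    have "dist (a i) (a k) + \<delta> \<le> dist (a i) (b j) + dist (a k) (b j)"
      using assms(1) ijk by (simp add: strict_triangles_def)
    then show "dist (a i) (a k) + \<delta> / 2 \<le> dist (a i) (b' j) + dist (a k) (b' j)"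
      using near[of j i] near[of j k] ijk by linarith
    assume "i \<noteq> k"
    then have "dist (a i) (b j) + \<delta> \<le> dist (a i) (a k) + dist (a k) (b j)"
      using assms(1) ijk by (simp add: strict_triangles_def)
    then show "dist (a i) (b' j) + \<delta> / 2 \<le> dist (a i) (a k) + dist (a k) (b' j)"
      using near[of j i] near[of j k] ijk by linarith
  qed
qed

lemma comeager_in_if_open_dense:
  assumes "openin X G" "X closure_of G = topspace X" "G \<subseteq> S" "S \<subseteq> topspace X"
  shows "comeager_in X S"
proof -
  have "X closure_of (topspace X - S) \<subseteq> topspace X - G"
    using assms(1,3) by (intro closure_of_minimal) auto
  then have "X interior_of (X closure_of (topspace X - S)) \<subseteq> X interior_of (topspace X - G)"
    by (rule interior_of_mono)
  also have "\<dots> = {}" using assms(2) by (simp add: interior_of_complement)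
  finally have "nowhere_dense_in X (topspace X - S)"
    by (simp add: nowhere_dense_in_def)
  then show ?thesis
    using assms(4) unfolding comeager_in_def meager_in_def
    by (intro conjI exI[of _ "\<lambda>_. topspace X - S"]) auto
qed

theorem lemma7:
  fixes n :: nat and a :: "nat \<Rightarrow> 'a::polish_space"
  assumes "urysohn_space TYPE('a)"
    and "a \<in> tuples n"
    and "inj_on a {..<n}"
  shows "ample n a"
proof -
  let ?X = "realization_space n (qftp n a)"
  let ?G = "{b \<in> realizations n (qftp n a). \<exists>\<delta>>0. strict_triangles n \<delta> a b}"
  have top: "topspace ?X = realizations n (qftp n a)"
    by (auto simp: realization_space_def realizations_def)
  have "b \<in> ?X closure_of ?G" if b: "b \<in> topspace ?X" for b
    unfolding in_closure_of
  proof (intro conjI allI impI b)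
    fix V assume "b \<in> V \<and> openin ?X V"
    then obtain \<epsilon> where \<epsilon>: "0 < \<epsilon>"
      "\<And>b'. b' \<in> realizations n (qftp n a) \<Longrightarrow> \<forall>j<n. dist (b' j) (b j) < \<epsilon> \<Longrightarrow> b' \<in> V"
      unfolding openin_realization_space_iff by meson
    obtain b' where b': "b' \<in> tuples n" "\<forall>j<n. \<forall>k<n. dist (b' j) (b' k) = dist (b j) (b k)"
      "\<forall>j<n. dist (b' j) (b j) = \<epsilon> / 2" "\<exists>\<delta>>0. strict_triangles n \<delta> a b'"
      using strict_triangles_approx[OF assms(1,3), of "\<epsilon> / 2" b] \<epsilon>(1) by auto
    have "b' \<in> realizations n (qftp n a)"
      using b b'(1,2) unfolding top realizations_qftp by auto
    moreover from this have "b' \<in> V" using \<epsilon>(1) b'(3) by (intro \<epsilon>(2)) auto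
    ultimately show "\<exists>b'. b' \<in> ?G \<and> b' \<in> V" using b'(4) by blast
  qed
  then have dense: "?X closure_of ?G = topspace ?X"
    by (intro equalityI closure_of_subset_topspace subsetI)
  have "openin ?X ?G"
    unfolding openin_realization_space_iff
  proof (intro conjI ballI)
    fix b assume "b \<in> ?G"
    then obtain \<delta> where \<delta>: "0 < \<delta>" "strict_triangles n \<delta> a b" by blast
    then have "b' \<in> ?G"
      if "b' \<in> realizations n (qftp n a)" "\<forall>j<n. dist (b' j) (b j) < \<delta> / 4" for b'
      using that strict_triangles_perturb[OF \<delta>(2), of b'] half_gt_zero by blast
    then show "\<exists>\<epsilon>>0. \<forall>b'\<in>realizations n (qftp n a).
        (\<forall>j<n. dist (b' j) (b j) < \<epsilon>) \<longrightarrow> b' \<in> ?G"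
      using \<delta>(1) by (intro exI[of _ "\<delta> / 4"]) auto
  qed auto
  then show ?thesis
    unfolding ample_def
  proof (rule comeager_in_if_open_dense[OF _ dense])
    show "?G \<subseteq> {b \<in> realizations n (qftp n a).
        \<exists>\<delta>>0. relatively_saturated n \<delta> a (tuple_image n (tuple_stabilizer n b) a)}"
      using strict_triangles_saturated[OF assms(1,3)] by blast
  qed (auto simp: top)
qed

end
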